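(* There is a function $f$ with $f(\mathrm{nnz})=O(\mathrm{nnz})$ such that the class of real $n\times n$ matrices is decisional $f$-reducible to the symbolic matrix class $\mathcal{SM}[\mathbb{R}[x_1,\ldots,x_{n^2}],1,3]$; that is, there is an algorithm running in time $\widetilde{O}(\mathrm{nnz}(\mathbf{A}))$ that, given $\mathbf{A}\in\mathbb{R}^{n\times n}$, outputs a square matrix $\mathbf{B}\in\mathcal{SM}[\mathbb{R}[x_1,\ldots,x_{n^2}],1,3]$ with $\mathrm{nnz}(\mathbf{B})\le f(\mathrm{nnz}(\mathbf{A}))$ such that $\det(\mathbf{A})=0$ if and only if $\det(\mathbf{B})$ is the zero polynomial.
   Context: For $R=\mathbb{F}[x_1,\ldots,x_t]$, write polynomials in canonical form as sums of distinct non-zero monomials $c\prod_i x_i^{I_i}$. The multiplicity of $x_j$ in a polynomial is the sum of its exponents $I_j$ over the monomials of the canonical form; the multiplicity $\mathrm{m}(x_j,\mathbf{A})$ of $x_j$ in a matrix $\mathbf{A}$ over $R$ is the sum over all entries; $\mathrm{nnz}(\mathbf{A})$ for a symbolic matrix is defined as $\sum_j \mathrm{m}(x_j,\mathbf{A})$ (for a scalar matrix it is the number of non-zero entries). $\mathcal{SM}[R,d,m]$ is the class of matrices over $R$ whose entries are polynomials with zero constant term, of total degree at most $d$, and in which every variable has multiplicity at most $m$. $\widetilde{O}$ hides $\mathrm{poly}(\log\log)$ factors. *)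

theory Defs
  imports
    "HOL-Library.Poly_Mapping"
    "HOL-Library.Landau_Symbols"
    "Jordan_Normal_Form.Determinant"
begin

section \<open>Multivariate polynomials and symbolic matrices\<close>

text \<open>
  A monomial is its exponent vector, a polynomial is the finitely supported map from monomials
  to coefficients. Thus \<open>keys p\<close> is the set of monomials of the canonical form of \<open>p\<close>.
\<close>

type_synonym monom = "nat \<Rightarrow>\<^sub>0 nat"
type_synonym 'a mpoly = "monom \<Rightarrow>\<^sub>0 'a"

definition monom_degree :: "monom \<Rightarrow> nat" where
  "monom_degree e = (\<Sum>j\<in>Poly_Mapping.keys e. Poly_Mapping.lookup e j)"

text \<open>The ring in the variables \<open>x\<^sub>1, \<dots>, x\<^sub>t\<close>.\<close>

definition poly_ring :: "nat \<Rightarrow> 'a::zero mpoly set" where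
  "poly_ring t = {p. \<forall>e\<in>Poly_Mapping.keys p. Poly_Mapping.keys e \<subseteq> {1..t}}"

definition multiplicity_poly :: "nat \<Rightarrow> 'a::zero mpoly \<Rightarrow> nat" where
  "multiplicity_poly j p = (\<Sum>e\<in>Poly_Mapping.keys p. Poly_Mapping.lookup e j)"

definition multiplicity_mat :: "nat \<Rightarrow> 'a::zero mpoly mat \<Rightarrow> nat" where
  "multiplicity_mat j A =
     (\<Sum>r<dim_row A. \<Sum>c<dim_col A. multiplicity_poly j (A $$ (r, c)))"

definition mat_vars :: "'a::zero mpoly mat \<Rightarrow> nat set" where
  "mat_vars A =
     (\<Union>r\<in>{..<dim_row A}. \<Union>c\<in>{..<dim_col A}.
        \<Union>e\<in>Poly_Mapping.keys (A $$ (r, c)). Poly_Mapping.keys e)"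

text \<open>Variables that do not occur in the matrix have multiplicity zero and are left out of the sum.\<close>

definition nnz_symbolic :: "'a::zero mpoly mat \<Rightarrow> nat" where
  "nnz_symbolic A = (\<Sum>j\<in>mat_vars A. multiplicity_mat j A)"

definition nnz_scalar :: "'a::zero mat \<Rightarrow> nat" where
  "nnz_scalar A = card {(r, c). r < dim_row A \<and> c < dim_col A \<and> A $$ (r, c) \<noteq> 0}"

text \<open>The class \<open>SM[R, d, m]\<close> for \<open>R\<close> the polynomial ring in \<open>t\<close> variables over the field \<open>'a\<close>.\<close>

definition SM :: "nat \<Rightarrow> nat \<Rightarrow> nat \<Rightarrow> 'a::field mpoly mat set" where
  "SM t d m =
     {A. (\<forall>r<dim_row A. \<forall>c<dim_col A.
            A $$ (r, c) \<in> poly_ring t \<and>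
            Poly_Mapping.lookup (A $$ (r, c)) 0 = 0 \<and>
            (\<forall>e\<in>Poly_Mapping.keys (A $$ (r, c)). monom_degree e \<le> d)) \<and>
         (\<forall>j\<in>{1..t}. multiplicity_mat j A \<le> m)}"

section \<open>A real RAM\<close>

text \<open>
  The memory consists of unbounded arrays of natural numbers (``words'') and unbounded arrays of
  reals, each array being identified by a number; a scalar variable is cell 0 of an array.
  A program mentions finitely many arrays, so this is the usual random access memory up to a
  constant factor. Words serve for counting and addressing and only admit addition, truncated
  subtraction and comparison, so that unit cost is not abused; reals admit the field operations
  and comparison. All real constants of a program are integers, hence no information can be
  hidden in them.
\<close>

record memory =
  wmem :: "nat \<Rightarrow> nat \<Rightarrow> nat"
  rmem :: "nat \<Rightarrow> nat \<Rightarrow> real"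

datatype wexp =
    WConst nat
  | WRead nat wexp
  | WAdd wexp wexp
  | WSub wexp wexp

datatype rexp =
    RConst int
  | RRead nat wexp
  | RAdd rexp rexp
  | RSub rexp rexp
  | RMul rexp rexp
  | RDiv rexp rexp

datatype bexp =
    WLess wexp wexp
  | RLess rexp rexp
  | BNot bexp
  | BAnd bexp bexp

datatype prog =
    Skip
  | WWrite nat wexp wexp
  | RWrite nat wexp rexp
  | Seq prog prog
  | Cond bexp prog prog
  | While bexp prog

primrec weval :: "memory \<Rightarrow> wexp \<Rightarrow> nat" where
  "weval s (WConst k) = k"
| "weval s (WRead a e) = wmem s a (weval s e)"
| "weval s (WAdd e1 e2) = weval s e1 + weval s e2"
| "weval s (WSub e1 e2) = weval s e1 - weval s e2"

primrec reval :: "memory \<Rightarrow> rexp \<Rightarrow> real" where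
  "reval s (RConst k) = of_int k"
| "reval s (RRead a e) = rmem s a (weval s e)"
| "reval s (RAdd e1 e2) = reval s e1 + reval s e2"
| "reval s (RSub e1 e2) = reval s e1 - reval s e2"
| "reval s (RMul e1 e2) = reval s e1 * reval s e2"
| "reval s (RDiv e1 e2) = reval s e1 / reval s e2"

primrec beval :: "memory \<Rightarrow> bexp \<Rightarrow> bool" where
  "beval s (WLess e1 e2) \<longleftrightarrow> weval s e1 < weval s e2"
| "beval s (RLess e1 e2) \<longleftrightarrow> reval s e1 < reval s e2"
| "beval s (BNot b) \<longleftrightarrow> \<not> beval s b"
| "beval s (BAnd b1 b2) \<longleftrightarrow> beval s b1 \<and> beval s b2"

text \<open>
  \<open>exec P s t s'\<close>: started in \<open>s\<close>, the program \<open>P\<close> halts in \<open>s'\<close> after \<open>t\<close> steps.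
  A step is an assignment or a test. As the expressions of a program are fixed in advance,
  this differs from counting single arithmetic operations and memory accesses by a
  factor that depends on the program only.
\<close>

inductive exec :: "prog \<Rightarrow> memory \<Rightarrow> nat \<Rightarrow> memory \<Rightarrow> bool" where
  Skip: "exec Skip s 1 s"
| WWrite: "exec (WWrite a i e) s 1
    (s\<lparr>wmem := (wmem s)(a := (wmem s a)(weval s i := weval s e))\<rparr>)"
| RWrite: "exec (RWrite a i e) s 1
    (s\<lparr>rmem := (rmem s)(a := (rmem s a)(weval s i := reval s e))\<rparr>)"
| Seq: "exec P s t s' \<Longrightarrow> exec Q s' t' s'' \<Longrightarrow> exec (Seq P Q) s (t + t') s''"
| CondTrue: "beval s b \<Longrightarrow> exec P s t s' \<Longrightarrow> exec (Cond b P Q) s (t + 1) s'"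
| CondFalse: "\<not> beval s b \<Longrightarrow> exec Q s t s' \<Longrightarrow> exec (Cond b P Q) s (t + 1) s'"
| WhileFalse: "\<not> beval s b \<Longrightarrow> exec (While b P) s 1 s"
| WhileTrue: "beval s b \<Longrightarrow> exec P s t s' \<Longrightarrow> exec (While b P) s' t' s'' \<Longrightarrow>
    exec (While b P) s (t + t' + 1) s''"

lemma exec_deterministic:
  "exec P s t s' \<Longrightarrow> exec P s u r \<Longrightarrow> u = t \<and> r = s'"
proof (induction arbitrary: u r rule: exec.induct)
  case (Skip s)
  then show ?case by (auto elim: exec.cases)
next
  case (WWrite a i e s)
  from WWrite.prems show ?case by cases simp_all
next
  case (RWrite a i e s)
  from RWrite.prems show ?case by cases simp_all
next
  case (Seq P s t s' Q t' s'')
  from Seq.prems show ?case by cases (use Seq.IH in blast)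
next
  case (CondTrue s b P t s' Q)
  from CondTrue.prems show ?case by cases (use CondTrue.hyps CondTrue.IH in blast)+
next
  case (CondFalse s b Q t s' P)
  from CondFalse.prems show ?case by cases (use CondFalse.hyps CondFalse.IH in blast)+
next
  case (WhileFalse s b P)
  from WhileFalse.prems show ?case by cases (use WhileFalse.hyps in blast)+
next
  case (WhileTrue s b P t s' t' s'')
  from WhileTrue.prems show ?case by cases (use WhileTrue.hyps WhileTrue.IH in blast)+
qed

section \<open>Representation of matrices in memory\<close>

text \<open>
  A scalar matrix is given by the list of its non-zero entries, in arbitrary order, a symbolic
  matrix by the list of the monomials in the canonical forms of its entries, again in arbitrary
  order. In the latter list a monomial is spelled out as a list of variables with repetitions.
\<close>

type_synonym scalar_list = "(nat \<times> nat \<times> real) list"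
type_synonym symbolic_list = "(nat \<times> nat \<times> nat list \<times> real) list"

definition lists_scalar :: "scalar_list \<Rightarrow> real mat \<Rightarrow> bool" where
  "lists_scalar L A \<longleftrightarrow> distinct L \<and>
     set L = {(r, c, a). r < dim_row A \<and> c < dim_col A \<and> a = A $$ (r, c) \<and> a \<noteq> 0}"

definition monom_of :: "nat list \<Rightarrow> monom" where
  "monom_of vs = (\<Sum>v\<leftarrow>vs. Poly_Mapping.single v 1)"

definition lists_symbolic :: "symbolic_list \<Rightarrow> real mpoly mat \<Rightarrow> bool" where
  "lists_symbolic L B \<longleftrightarrow>
     (let L' = map (\<lambda>(r, c, vs, a). (r, c, monom_of vs, a)) L
      in distinct L' \<and>
         set L' = {(r, c, e, a). r < dim_row B \<and> c < dim_col B \<and>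
                     e \<in> Poly_Mapping.keys (B $$ (r, c)) \<and> a = Poly_Mapping.lookup (B $$ (r, c)) e})"

definition scalar_words :: "nat \<Rightarrow> scalar_list \<Rightarrow> nat list" where
  "scalar_words n L = n # length L # concat (map (\<lambda>(r, c, a). [r, c]) L)"

definition scalar_reals :: "scalar_list \<Rightarrow> real list" where
  "scalar_reals L = map (\<lambda>(r, c, a). a) L"

definition symbolic_words :: "nat \<Rightarrow> symbolic_list \<Rightarrow> nat list" where
  "symbolic_words n L =
     n # length L # concat (map (\<lambda>(r, c, vs, a). r # c # length vs # vs) L)"

definition symbolic_reals :: "symbolic_list \<Rightarrow> real list" where
  "symbolic_reals L = map (\<lambda>(r, c, vs, a). a) L"

text \<open>The input occupies the arrays with number 0; the rest of the memory is zero.\<close>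

definition array_of :: "'b::zero list \<Rightarrow> nat \<Rightarrow> nat \<Rightarrow> 'b" where
  "array_of xs a i = (if a = 0 \<and> i < length xs then xs ! i else 0)"

definition input_memory :: "nat \<Rightarrow> scalar_list \<Rightarrow> memory" where
  "input_memory n L =
     \<lparr>wmem = array_of (scalar_words n L), rmem = array_of (scalar_reals L)\<rparr>"

text \<open>The output, a square matrix, is found at the beginning of the arrays with number 1.\<close>

definition output_of :: "memory \<Rightarrow> real mpoly mat \<Rightarrow> bool" where
  "output_of s B \<longleftrightarrow>
     (\<exists>L. lists_symbolic L B \<and>
        (\<forall>i<length (symbolic_words (dim_row B) L).
           wmem s 1 i = symbolic_words (dim_row B) L ! i) \<and>
        (\<forall>i<length (symbolic_reals L). rmem s 1 i = symbolic_reals L ! i))"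

section \<open>Decisional reducibility\<close>

definition soft_O :: "(nat \<Rightarrow> real) \<Rightarrow> (nat \<Rightarrow> real) set" where
  "soft_O g = (\<Union>k. O(\<lambda>N. g N * ln (ln (g N)) ^ k))"

text \<open>
  A class of matrices is given as a family indexed by the dimension \<open>n\<close> of the scalar matrices
  to be reduced. The program \<open>P\<close> and the functions \<open>f\<close> and \<open>T\<close> are the same for all \<open>n\<close>.
\<close>

definition decisional_reducible ::
    "(nat \<Rightarrow> nat) \<Rightarrow> (nat \<Rightarrow> real mat set) \<Rightarrow> (nat \<Rightarrow> real mpoly mat set) \<Rightarrow> bool" where
  "decisional_reducible f C D \<longleftrightarrow>
     (\<exists>P T. (\<lambda>N. real (T N)) \<in> soft_O (\<lambda>N. real N) \<and>
        (\<forall>n. \<forall>A\<in>C n \<inter> carrier_mat n n. \<forall>L. lists_scalar L A \<longrightarrow>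
           (\<exists>t s B. exec P (input_memory n L) t s \<and> t \<le> T (nnz_scalar A) \<and>
              output_of s B \<and> B \<in> D n \<and> square_mat B \<and>
              nnz_symbolic B \<le> f (nnz_scalar A) \<and>
              (det A = 0 \<longleftrightarrow> det B = 0))))"

end

theory Submission
  imports Defs
begin

text \<open>
  A row of \<open>A\<close> with the non-zero entries \<open>a\<^sub>1, \<dots>, a\<^sub>k\<close> is split into \<open>k\<close> rows, one per entry, which
  are chained by \<open>k - 1\<close> new columns: column \<open>t\<close> has a \<open>1\<close> in the row of \<open>a\<^sub>t\<close> and a \<open>-1\<close> in the
  row of \<open>a\<^bsub>t+1\<^esub>\<close>. The left kernel of the resulting matrix \<open>M\<close> consists of the vectors that are
  constant on each chain, so it is the left kernel of \<open>A\<close>. Every row of \<open>M\<close> has at most three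
  non-zero entries. Multiplying row \<open>i\<close> by \<open>x\<^sub>i\<close> therefore gives a matrix in which every variable has
  multiplicity at most three, and whose determinant is \<open>det M\<close> times a monomial.

  If \<open>A\<close> has a zero row, then \<open>M\<close> has more columns than rows; it is made square by zero rows,
  so that both determinants vanish. Hence no case distinction is needed in the program, whose running
  time does not depend on \<open>n\<close>: a single pass over the entries, with a table of the last entry seen
  in each row.
\<close>

section \<open>Scaling the rows by variables\<close>

lemma single_eq_0_iff: "Poly_Mapping.single k v = 0 \<longleftrightarrow> v = 0"
  by (metis lookup_single_eq lookup_zero single_zero)

text \<open>Rows are counted from 0 but the variables of \<open>poly_ring\<close> from 1, whence
  \<open>Suc i\<close>.\<close>

definition row_vars :: "real mat \<Rightarrow> real mpoly mat" where
  "row_vars M = mat (dim_row M) (dim_col M)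
     (\<lambda>(i, j). Poly_Mapping.single (Poly_Mapping.single (Suc i) 1) (M $$ (i, j)))"

lemma row_vars_dim [simp]:
  "dim_row (row_vars M) = dim_row M" "dim_col (row_vars M) = dim_col M"
  by (simp_all add: row_vars_def)

lemma row_vars_index [simp]:
  "i < dim_row M \<Longrightarrow> j < dim_col M \<Longrightarrow>
    row_vars M $$ (i, j) = Poly_Mapping.single (Poly_Mapping.single (Suc i) 1) (M $$ (i, j))"
  by (simp add: row_vars_def)

lemma prod_single:
  "finite S \<Longrightarrow> (\<Prod>i\<in>S. Poly_Mapping.single (e i) (c i)) =
     Poly_Mapping.single (\<Sum>i\<in>S. e i) (\<Prod>i\<in>S. (c i :: 'a::comm_semiring_1))"
  by (induction S rule: finite_induct) (simp_all add: mult_single)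

lemma sum_single:
  "finite S \<Longrightarrow> (\<Sum>i\<in>S. Poly_Mapping.single e (c i)) = Poly_Mapping.single e (\<Sum>i\<in>S. c i)"
  by (induction S rule: finite_induct) (simp_all add: single_add)

lemma signof_times_single:
  "(signof p :: 'a::comm_ring_1 mpoly) * Poly_Mapping.single e c =
     Poly_Mapping.single e (signof p * c)"
  by (simp add: sign_def single_uminus)

text \<open>Every term of the Leibniz expansion takes one entry from each row, so all terms carry
  the same monomial, the product of the row variables, which factors out.\<close>

lemma det_row_vars:
  assumes "M \<in> carrier_mat n n"
  shows "det (row_vars M) =
    Poly_Mapping.single (\<Sum>i<n. Poly_Mapping.single (Suc i) 1) (det M)"
proof -
  have "det (row_vars M) = (\<Sum>p\<in>{p. p permutes {0..<n}}.
      signof p * (\<Prod>i = 0..<n. Poly_Mapping.single (Poly_Mapping.single (Suc i) 1) (M $$ (i, p i))))"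
    using assms permutes_in_image
    by (subst det_def'[of _ n]) (fastforce intro!: sum.cong prod.cong arg_cong2[where f = times])+
  also have "\<dots> = (\<Sum>p\<in>{p. p permutes {0..<n}}.
      Poly_Mapping.single (\<Sum>i<n. Poly_Mapping.single (Suc i) 1)
        (signof p * (\<Prod>i = 0..<n. M $$ (i, p i))))"
    by (simp add: prod_single signof_times_single lessThan_atLeast0)
  also have "\<dots> = Poly_Mapping.single (\<Sum>i<n. Poly_Mapping.single (Suc i) 1) (det M)"
    using assms by (simp add: sum_single finite_permutations det_def')
  finally show ?thesis .
qed

section \<open>Multiplicities in the scaled matrix\<close>

lemma multiplicity_poly_single_var:
  "multiplicity_poly j (Poly_Mapping.single (Poly_Mapping.single i 1) c) =
     (if c \<noteq> 0 \<and> i = j then 1 else 0)"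
  by (simp add: multiplicity_poly_def lookup_single when_def)

lemma multiplicity_row_vars:
  "multiplicity_mat j (row_vars M) =
     (\<Sum>i<dim_row M. if Suc i = j then card {c. c < dim_col M \<and> M $$ (i, c) \<noteq> 0} else 0)"
  unfolding multiplicity_mat_def row_vars_dim
proof (rule sum.cong[OF refl])
  fix i assume "i \<in> {..<dim_row M}"
  then have "(\<Sum>c<dim_col M. multiplicity_poly j (row_vars M $$ (i, c))) =
      (\<Sum>c<dim_col M. if M $$ (i, c) \<noteq> 0 \<and> Suc i = j then 1 else 0)"
    by (intro sum.cong) (simp_all add: multiplicity_poly_single_var del: One_nat_def)
  also have "\<dots> = (if Suc i = j then card {c. c < dim_col M \<and> M $$ (i, c) \<noteq> 0} else 0)"
    by (simp add: sum.If_cases Int_def)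
  finally show "(\<Sum>c<dim_col M. multiplicity_poly j (row_vars M $$ (i, c))) =
      (if Suc i = j then card {c. c < dim_col M \<and> M $$ (i, c) \<noteq> 0} else 0)" .
qed

lemma multiplicity_row_vars_le:
  assumes "\<And>i. i < dim_row M \<Longrightarrow> card {c. c < dim_col M \<and> M $$ (i, c) \<noteq> 0} \<le> m"
  shows "multiplicity_mat j (row_vars M) \<le> m"
proof (cases j)
  case 0
  then show ?thesis by (simp add: multiplicity_row_vars)
next
  case (Suc i)
  then show ?thesis
    using assms[of i] by (simp add: multiplicity_row_vars sum.delta)
qed

text \<open>A zero row brings in no variable, so the number of variables is governed by the indices
  of the non-zero rows rather than by the dimension.\<close>

lemma row_vars_in_SM:
  assumes "\<And>i. i < dim_row M \<Longrightarrow> card {c. c < dim_col M \<and> M $$ (i, c) \<noteq> 0} \<le> m"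
    and "\<And>i c. i < dim_row M \<Longrightarrow> c < dim_col M \<Longrightarrow> M $$ (i, c) \<noteq> 0 \<Longrightarrow> i < t"
  shows "row_vars M \<in> SM t 1 m"
proof -
  \<comment> \<open>The monomial of a variable is not the constant monomial, so all constant terms
    vanish.\<close>
  have "(0::monom) \<noteq> Poly_Mapping.single (Suc i) 1" for i
    by (metis keys_single keys_zero empty_not_insert zero_neq_one)
  then show ?thesis
    using assms(2) multiplicity_row_vars_le[OF assms(1)]
    by (auto simp: SM_def poly_ring_def lookup_single monom_degree_def when_def Suc_le_eq
        split: if_splits)
qed

text \<open>Applied with \<open>N\<close> the number of entries of \<open>A\<close>: the zero rows
  that make the matrix square do not count.\<close>

lemma nnz_row_vars_le:
  assumes "\<And>i. i < dim_row M \<Longrightarrow> card {c. c < dim_col M \<and> M $$ (i, c) \<noteq> 0} \<le> m"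
    and "\<And>i c. i < dim_row M \<Longrightarrow> c < dim_col M \<Longrightarrow> M $$ (i, c) \<noteq> 0 \<Longrightarrow> i < N"
  shows "nnz_symbolic (row_vars M) \<le> m * N"
proof -
  have vars: "mat_vars (row_vars M) \<subseteq> {1..N}"
    using assms(2) by (auto simp: mat_vars_def Suc_le_eq split: if_splits)
  have "nnz_symbolic (row_vars M) \<le> (\<Sum>j\<in>mat_vars (row_vars M). m)"
    unfolding nnz_symbolic_def by (intro sum_mono multiplicity_row_vars_le assms(1))
  also have "\<dots> \<le> m * N"
    using card_mono[OF _ vars] by simp
  finally show ?thesis .
qed

text \<open>The row index determines the variable, so attaching the variable to each triple neither
  merges nor duplicates entries.\<close>

lemma lists_symbolic_row_vars:
  assumes "lists_scalar E M"
  shows "lists_symbolic (map (\<lambda>(r, c, a). (r, c, [Suc r], a)) E) (row_vars M)"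
proof -
  let ?g = "\<lambda>(r, c, a). (r, c, Poly_Mapping.single (Suc r) (1::nat), a::real)"
  have eq: "map (\<lambda>(r, c, vs, a). (r, c, monom_of vs, a)) (map (\<lambda>(r, c, a). (r, c, [Suc r], a)) E)
      = map ?g E"
    by (auto simp: monom_of_def)
  have "inj_on ?g (set E)"
    by (auto simp: inj_on_def)
  moreover have "?g ` set E = {(r, c, e, a). r < dim_row M \<and> c < dim_col M \<and>
      e \<in> Poly_Mapping.keys (row_vars M $$ (r, c)) \<and>
      a = Poly_Mapping.lookup (row_vars M $$ (r, c)) e}"
    (is "_ = ?K")
  proof
    show "?g ` set E \<subseteq> ?K"
    proof (rule image_subsetI)
      fix x assume "x \<in> set E"
      moreover obtain r c a where "x = (r, c, a)"
        by (cases x)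
      ultimately show "?g x \<in> ?K"
        using assms by (simp add: lists_scalar_def)
    qed
    show "?K \<subseteq> ?g ` set E"
    proof clarify
      fix r c e assume *: "r < dim_row M" "c < dim_col M"
        "e \<in> Poly_Mapping.keys (row_vars M $$ (r, c))"
      then have "M $$ (r, c) \<noteq> 0" "e = Poly_Mapping.single (Suc r) 1"
        by (auto split: if_splits)
      moreover from this have "(r, c, M $$ (r, c)) \<in> set E"
        using assms * by (simp add: lists_scalar_def)
      then have "?g (r, c, M $$ (r, c)) \<in> ?g ` set E"
        by (rule imageI)
      ultimately show "(r, c, e, Poly_Mapping.lookup (row_vars M $$ (r, c)) e) \<in> ?g ` set E"
        using * by simp
    qed
  qed
  ultimately show ?thesis
    using assms unfolding lists_symbolic_def eq Let_def set_map row_vars_dim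
    by (intro conjI) (simp_all only: distinct_map lists_scalar_def)
qed

section \<open>Splitting the rows\<close>

text \<open>Positions are shifted by one, since the table starts out as zero.\<close>

primrec last_in_row :: "(nat \<Rightarrow> nat) \<Rightarrow> nat \<Rightarrow> nat \<Rightarrow> nat" where
  "last_in_row R 0 = (\<lambda>_. 0)"
| "last_in_row R (Suc k) = (last_in_row R k)(R k := Suc k)"

text \<open>The recursion follows the pass over the entries, so that the position of a link in the
  list is the number of its new column, counted from \<open>n\<close>.\<close>

primrec links :: "(nat \<Rightarrow> nat) \<Rightarrow> nat \<Rightarrow> (nat \<times> nat) list" where
  "links R 0 = []"
| "links R (Suc k) = links R k @
     (if last_in_row R k (R k) = 0 then [] else [(last_in_row R k (R k) - 1, k)])"

lemma last_in_row_eq_0_iff: "last_in_row R k x = 0 \<longleftrightarrow> (\<forall>j<k. R j \<noteq> x)"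
  by (induction k) (auto simp: less_Suc_eq)

lemma last_in_row_eq_Suc_iff:
  "last_in_row R k x = Suc p \<longleftrightarrow> p < k \<and> R p = x \<and> (\<forall>j. p < j \<and> j < k \<longrightarrow> R j \<noteq> x)"
  by (induction k) (auto simp: less_Suc_eq)

text \<open>The table holds the latest earlier position of each row, so a new link joins two
  positions of the row with none in between. Distinctness and injectivity of the links are read off
  from this description.\<close>

lemma set_links:
  "set (links R k) =
     {(p, q). p < q \<and> q < k \<and> R p = R q \<and> (\<forall>j. p < j \<and> j < q \<longrightarrow> R j \<noteq> R q)}"
proof (induction k)
  case (Suc k)
  show ?case
  proof (cases "last_in_row R k (R k)")
    case 0
    then show ?thesis
      using Suc by (auto simp: last_in_row_eq_0_iff less_Suc_eq)
  next
    case (Suc p)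
    have "p' = p" if "p' < k" "R p' = R k" "\<forall>j. p' < j \<and> j < k \<longrightarrow> R j \<noteq> R k" for p'
      using Suc that last_in_row_eq_Suc_iff[of R k "R k" p'] by simp
    then show ?thesis
      using Suc.IH Suc last_in_row_eq_Suc_iff[of R k "R k" p] by (auto simp: less_Suc_eq)
  qed
qed simp

lemma distinct_links: "distinct (links R k)"
  by (induction k) (auto simp: set_links)

text \<open>Every position is either the first of its row or the end of exactly one link.\<close>

lemma length_links: "length (links R k) + card (R ` {..<k}) = k"
proof (induction k)
  case (Suc k)
  have "R k \<in> R ` {..<k} \<longleftrightarrow> last_in_row R k (R k) \<noteq> 0"
    unfolding last_in_row_eq_0_iff image_iff by (metis lessThan_iff)
  then show ?case
    using Suc by (auto simp: lessThan_Suc card_insert_if)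
qed simp

lemma links_nth:
  assumes "t < length (links R k)"
  shows "fst (links R k ! t) < snd (links R k ! t)" "snd (links R k ! t) < k"
    "R (fst (links R k ! t)) = R (snd (links R k ! t))"
  using nth_mem[OF assms] by (auto simp: set_links)

text \<open>A position has at most one successor in its row: of two candidates, the smaller would
  lie strictly inside the other link.\<close>

lemma links_fst_inj:
  assumes "s < length (links R k)" "t < length (links R k)"
    "fst (links R k ! s) = fst (links R k ! t)"
  shows "s = t"
proof -
  have "q = q'" if "(p, q) \<in> set (links R k)" "(p, q') \<in> set (links R k)" for p q q'
    using that by (auto simp: set_links) (metis linorder_neqE_nat)
  then show ?thesis
    by (metis assms distinct_links nth_eq_iff_index_eq nth_mem prod.collapse)
qed

text \<open>Likewise, a position has at most one predecessor in its row.\<close>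

lemma links_snd_inj:
  assumes "s < length (links R k)" "t < length (links R k)"
    "snd (links R k ! s) = snd (links R k ! t)"
  shows "s = t"
proof -
  have "p = p'" if "(p, q) \<in> set (links R k)" "(p', q) \<in> set (links R k)" for p p' q
    using that by (auto simp: set_links) (metis linorder_neqE_nat)
  then show ?thesis
    by (metis assms distinct_links nth_eq_iff_index_eq nth_mem prod.collapse)
qed

text \<open>Let \<open>i\<close> be the earlier position. Walking back from \<open>j\<close> along
  the links reaches \<open>i\<close>, because the link into \<open>j\<close> starts at the last
  earlier position of the row, which cannot precede \<open>i\<close>.\<close>

lemma constant_on_rows_if_links:
  assumes "\<And>p q. (p, q) \<in> set (links R k) \<Longrightarrow> w p = w q" "i < k" "j < k" "R i = R j"
  shows "w i = w j"
proof -
  have "i \<le> j \<Longrightarrow> w i = w j" if "i < k" "j < k" "R i = R j" for i j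
    using that
  proof (induction j rule: less_induct)
    case (less j)
    show ?case
    proof (cases "i = j")
      case False
      then have "last_in_row R j (R j) \<noteq> 0"
        using less.prems by (metis last_in_row_eq_0_iff le_neq_implies_less)
      then obtain p where p: "last_in_row R j (R j) = Suc p"
        using not0_implies_Suc by blast
      then have "p < j" "R p = R j" "\<forall>l. p < l \<and> l < j \<longrightarrow> R l \<noteq> R j"
        by (auto simp: last_in_row_eq_Suc_iff)
      moreover from this have "i \<le> p"
        using less.prems False by (meson le_neq_implies_less not_le_imp_less)
      ultimately show ?thesis
        using less.IH[of p] less.prems assms(1)[of p j] by (simp add: set_links)
    qed simp
  qed
  then show ?thesis
    using assms(2-4) by (metis nat_le_linear)
qed

section \<open>The split matrix and the list of its non-zero entries\<close>

abbreviation entry_row :: "scalar_list \<Rightarrow> nat \<Rightarrow> nat" where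
  "entry_row L i \<equiv> fst (L ! i)"

abbreviation entry_col :: "scalar_list \<Rightarrow> nat \<Rightarrow> nat" where
  "entry_col L i \<equiv> fst (snd (L ! i))"

abbreviation entry_val :: "scalar_list \<Rightarrow> nat \<Rightarrow> real" where
  "entry_val L i \<equiv> snd (snd (L ! i))"

abbreviation entry_links :: "scalar_list \<Rightarrow> (nat \<times> nat) list" where
  "entry_links L \<equiv> links (entry_row L) (length L)"

definition split_dim :: "nat \<Rightarrow> scalar_list \<Rightarrow> nat" where
  "split_dim n L = n + length (entry_links L)"

text \<open>Row \<open>i\<close> belongs to the \<open>i\<close>-th listed entry, a column below
  \<open>n\<close> is a column of the original matrix, and column \<open>n + t\<close> belongs to
  link \<open>t\<close>. Links join positions below \<open>length L\<close>, so all rows from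
  \<open>length L\<close> on are zero padding.\<close>

definition split_mat :: "nat \<Rightarrow> scalar_list \<Rightarrow> real mat" where
  "split_mat n L = mat (split_dim n L) (split_dim n L) (\<lambda>(i, j).
     if j < n then if i < length L \<and> entry_col L i = j then entry_val L i else 0
     else if i = fst (entry_links L ! (j - n)) then 1
     else if i = snd (entry_links L ! (j - n)) then -1 else 0)"

lemma split_mat_carrier: "split_mat n L \<in> carrier_mat (split_dim n L) (split_dim n L)"
  by (simp add: split_mat_def)

lemma split_mat_dim [simp]:
  "dim_row (split_mat n L) = split_dim n L" "dim_col (split_mat n L) = split_dim n L"
  by (simp_all add: split_mat_def)

text \<open>The triples come in the order in which the program emits them. \<open>l - 1\<close>
  undoes the shift of the table, and \<open>c\<close> is the column of the link that ends at
  \<open>k\<close>.\<close>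

primrec split_entries :: "nat \<Rightarrow> scalar_list \<Rightarrow> nat \<Rightarrow> scalar_list" where
  "split_entries n L 0 = []"
| "split_entries n L (Suc k) = split_entries n L k @ [(k, entry_col L k, entry_val L k)] @
     (let l = last_in_row (entry_row L) k (entry_row L k);
          c = n + length (links (entry_row L) k)
      in if l = 0 then [] else [(l - 1, c, 1), (k, c, -1)])"

lemma set_split_entries:
  "set (split_entries n L k) = {(i, entry_col L i, entry_val L i) |i. i < k} \<union>
     {(fst (links (entry_row L) k ! t), n + t, 1) |t. t < length (links (entry_row L) k)} \<union>
     {(snd (links (entry_row L) k ! t), n + t, -1) |t. t < length (links (entry_row L) k)}"
  by (induction k) (auto simp: Let_def less_Suc_eq nth_append)

lemma split_entries_bounds:
  assumes "set L \<subseteq> {(r, c, a). r < n \<and> c < n \<and> a \<noteq> 0}" "k \<le> length L"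
    "(i, j, a) \<in> set (split_entries n L k)"
  shows "i < k \<and> j < n + length (links (entry_row L) k) \<and> a \<noteq> 0"
proof -
  have "entry_col L i < n" "entry_val L i \<noteq> 0" if "i < k" for i
    using assms(1,2) that nth_mem[of i L] by fastforce+
  moreover have "fst (links (entry_row L) k ! t) < k" "snd (links (entry_row L) k ! t) < k"
    if "t < length (links (entry_row L) k)" for t
    using links_nth(1,2)[OF that] by simp_all
  ultimately show ?thesis
    using assms(3) by (auto simp: set_split_entries trans_less_add1 simp del: prod.collapse)
qed

text \<open>Every triple added for \<open>k\<close> lies in row \<open>k\<close> or in the newest
  column, and no earlier triple does. The original entry differs from the new \<open>-1\<close> in
  the same row because its column is below \<open>n\<close>.\<close>

lemma distinct_split_entries:
  assumes "set L \<subseteq> {(r, c, a). r < n \<and> c < n \<and> a \<noteq> 0}" "k \<le> length L"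
  shows "distinct (split_entries n L k)"
  using assms(2)
proof (induction k)
  case (Suc k)
  have "(k, j, a) \<notin> set (split_entries n L k)"
    "(i, n + length (links (entry_row L) k), a) \<notin> set (split_entries n L k)" for i j a
    using split_entries_bounds[OF assms(1), of k] Suc.prems by fastforce+
  moreover have "entry_col L k < n"
    using assms(1) Suc.prems nth_mem[of k L] by fastforce
  ultimately show ?case
    using Suc by (cases "L ! k") (auto simp: Let_def)
qed simp

section \<open>Size and sparsity of the split matrix\<close>

locale sparse_matrix =
  fixes n :: nat and A :: "real mat" and L :: scalar_list
  assumes A: "A \<in> carrier_mat n n" and L: "lists_scalar L A"
begin

abbreviation R where "R \<equiv> entry_row L"
abbreviation D where "D \<equiv> split_dim n L"

lemma set_L: "set L = {(r, c, a). r < n \<and> c < n \<and> a = A $$ (r, c) \<and> a \<noteq> 0}"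
  and distinct_L: "distinct L"
  using A L by (auto simp: lists_scalar_def)

lemma set_L_subset: "set L \<subseteq> {(r, c, a). r < n \<and> c < n \<and> a \<noteq> 0}"
  by (auto simp: set_L)

lemma entry:
  assumes "i < length L"
  shows "R i < n" "entry_col L i < n" "entry_val L i = A $$ (R i, entry_col L i)"
    "entry_val L i \<noteq> 0"
  using nth_mem[OF assms] by (auto simp: set_L)

lemma rows_subset: "R ` {..<length L} \<subseteq> {..<n}"
  using entry(1) by auto

text \<open>By \<open>length_links\<close>, \<open>D\<close> exceeds \<open>length L\<close> by the
  number of rows of \<open>A\<close> without entries.\<close>

lemma length_L_le_split_dim: "length L \<le> D"
  using length_links[of R "length L"] card_mono[OF _ rows_subset] by (simp add: split_dim_def)

lemma split_dim_eq_length_iff: "D = length L \<longleftrightarrow> (\<forall>x<n. \<exists>i<length L. R i = x)"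
proof -
  have "D = length L \<longleftrightarrow> card (R ` {..<length L}) = card {..<n}"
    using length_links[of R "length L"] by (auto simp: split_dim_def)
  also have "\<dots> \<longleftrightarrow> R ` {..<length L} = {..<n}"
    using rows_subset card_subset_eq by (metis finite_lessThan)
  also have "\<dots> \<longleftrightarrow> {..<n} \<subseteq> R ` {..<length L}"
    using rows_subset by blast
  also have "\<dots> \<longleftrightarrow> (\<forall>x<n. \<exists>i<length L. R i = x)"
    by (force simp: image_iff)
  finally show ?thesis .
qed

lemma nnz_A: "nnz_scalar A = length L"
proof -
  have "{(r, c). r < dim_row A \<and> c < dim_col A \<and> A $$ (r, c) \<noteq> 0} = (\<lambda>(r, c, a). (r, c)) ` set L"
    using A by (auto simp: set_L image_iff)
  moreover have "inj_on (\<lambda>(r, c, a). (r, c)) (set L)"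
    by (auto simp: inj_on_def set_L)
  ultimately show ?thesis
    by (simp add: nnz_scalar_def card_image distinct_card distinct_L)
qed

lemma length_L_le: "length L \<le> n\<^sup>2"
proof -
  have "{(r, c). r < dim_row A \<and> c < dim_col A \<and> A $$ (r, c) \<noteq> 0} \<subseteq> {..<n} \<times> {..<n}"
    using A by auto
  then have "nnz_scalar A \<le> card ({..<n} \<times> {..<n})"
    unfolding nnz_scalar_def by (intro card_mono) auto
  then show ?thesis
    by (simp add: nnz_A power2_eq_square)
qed

lemma lists_split_mat: "lists_scalar (split_entries n L (length L)) (split_mat n L)"
proof -
  have "set (split_entries n L (length L)) = {(i, j, a). i < D \<and> j < D \<and>
      a = split_mat n L $$ (i, j) \<and> a \<noteq> 0}" (is "?S = ?T")
  proof
    show "?S \<subseteq> ?T"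
    proof clarify
      fix i j a assume ija: "(i, j, a) \<in> ?S"
      have "i < D" "j < D" "a \<noteq> 0"
        using split_entries_bounds[OF set_L_subset order_refl ija] length_L_le_split_dim
        by (auto simp: split_dim_def)
      moreover from this have "a = split_mat n L $$ (i, j)"
        using ija unfolding set_split_entries
      proof (elim UnE CollectE exE conjE)
        fix i' assume i': "(i, j, a) = (i', entry_col L i', entry_val L i')" "i' < length L"
        then have "i = i'" "j = entry_col L i'" "a = entry_val L i'"
          by (simp_all del: prod.collapse)
        then show ?thesis
          using i'(2) entry(2)[OF i'(2)] \<open>i < D\<close> \<open>j < D\<close> by (simp add: split_mat_def)
      next
        fix t assume "(i, j, a) = (fst (entry_links L ! t), n + t, 1)"
        then show ?thesis
          using \<open>i < D\<close> \<open>j < D\<close> by (simp add: split_mat_def)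
      next
        \<comment> \<open>The two ends of a link differ, so the test for the entry \<open>1\<close>,
          which comes first in \<open>split_mat\<close>, does not hide the
          \<open>-1\<close>.\<close>
        fix t assume "(i, j, a) = (snd (entry_links L ! t), n + t, -1)"
          "t < length (entry_links L)"
        then show ?thesis
          using links_nth(1)[of t R "length L"] \<open>i < D\<close> \<open>j < D\<close> by (simp add: split_mat_def)
      qed
      ultimately show "i < D \<and> j < D \<and> a = split_mat n L $$ (i, j) \<and> a \<noteq> 0"
        by blast
    qed
    show "?T \<subseteq> ?S"
    proof clarify
      fix i j assume *: "i < D" "j < D" "split_mat n L $$ (i, j) \<noteq> 0"
      show "(i, j, split_mat n L $$ (i, j)) \<in> ?S"
      proof (cases "j < n")
        case True
        then show ?thesis
          using * by (auto simp: set_split_entries split_mat_def split: if_splits)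
      next
        case False
        define t where "t = j - n"
        have "j = n + t" "t < length (entry_links L)"
          using False * by (auto simp: t_def split_dim_def)
        then show ?thesis
          using * by (auto simp: set_split_entries split_mat_def split: if_splits)
      qed
    qed
  qed
  then show ?thesis
    using distinct_split_entries[OF set_L_subset] by (simp add: lists_scalar_def)
qed

lemma split_mat_nonzero_row:
  assumes "i < D" "j < D" "split_mat n L $$ (i, j) \<noteq> 0"
  shows "i < length L"
proof -
  have "(i, j, split_mat n L $$ (i, j)) \<in> set (split_entries n L (length L))"
    using lists_split_mat assms by (simp add: lists_scalar_def)
  then show ?thesis
    using split_entries_bounds[OF set_L_subset order_refl] by blast
qed

text \<open>A row holds its own entry of \<open>A\<close>, at most one link that starts there and at
  most one that ends there.\<close>

lemma card_row_split_mat: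
  assumes "i < D"
  shows "card {c. c < D \<and> split_mat n L $$ (i, c) \<noteq> 0} \<le> 3"
proof -
  let ?F = "{n + t |t. t < length (entry_links L) \<and> fst (entry_links L ! t) = i}"
  let ?G = "{n + t |t. t < length (entry_links L) \<and> snd (entry_links L ! t) = i}"
  have card: "card ?F \<le> Suc 0" "card ?G \<le> Suc 0"
    by (subst card_le_Suc0_iff_eq; use links_fst_inj[of _ R] links_snd_inj[of _ R] in auto)+
  have "{c. c < D \<and> split_mat n L $$ (i, c) \<noteq> 0} \<subseteq> insert (entry_col L i) (?F \<union> ?G)"
  proof
    fix c assume "c \<in> {c. c < D \<and> split_mat n L $$ (i, c) \<noteq> 0}"
    then have "(i, c, split_mat n L $$ (i, c)) \<in> set (split_entries n L (length L))"
      using lists_split_mat assms by (simp add: lists_scalar_def)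
    then show "c \<in> insert (entry_col L i) (?F \<union> ?G)"
      by (auto simp: set_split_entries simp del: prod.collapse)
  qed
  then have "card {c. c < D \<and> split_mat n L $$ (i, c) \<noteq> 0} \<le> card (insert (entry_col L i) (?F \<union> ?G))"
    by (intro card_mono) auto
  also have "\<dots> \<le> Suc (card (?F \<union> ?G))"
    by (rule card_insert_le_m1) auto
  also have "\<dots> \<le> 3"
    using card card_Un_le[of ?F ?G] by simp
  finally show ?thesis .
qed

end

section \<open>Singularity and left kernels\<close>

lemma det_eq_0_iff_left_kernel:
  fixes M :: "'a::field mat"
  assumes M: "M \<in> carrier_mat n n"
  shows "det M = 0 \<longleftrightarrow> (\<exists>w. (\<exists>i<n. w i \<noteq> 0) \<and> (\<forall>j<n. (\<Sum>i<n. M $$ (i, j) * w i) = 0))"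
proof -
  have mult: "(transpose_mat M *\<^sub>v v) $ j = (\<Sum>i<n. M $$ (i, j) * v $ i)"
    if "v \<in> carrier_vec n" "j < n" for v j
    using that M by (auto simp: scalar_prod_def lessThan_atLeast0 intro!: sum.cong)
  \<comment> \<open>Transposition preserves the determinant, so the criterion for the right kernel
    carries over.\<close>
  have "det M = 0 \<longleftrightarrow>
      (\<exists>v. v \<in> carrier_vec n \<and> v \<noteq> 0\<^sub>v n \<and> transpose_mat M *\<^sub>v v = 0\<^sub>v n)"
    using M by (simp add: det_transpose flip: det_0_iff_vec_prod_zero_field)
  also have "\<dots> \<longleftrightarrow> (\<exists>v. v \<in> carrier_vec n \<and> (\<exists>i<n. v $ i \<noteq> 0) \<and>
      (\<forall>j<n. (\<Sum>i<n. M $$ (i, j) * v $ i) = 0))"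
  proof (intro ex_cong conj_cong refl)
    fix v :: "'a vec" assume v: "v \<in> carrier_vec n"
    show "v \<noteq> 0\<^sub>v n \<longleftrightarrow> (\<exists>i<n. v $ i \<noteq> 0)"
      using v by (auto simp: vec_eq_iff)
    show "transpose_mat M *\<^sub>v v = 0\<^sub>v n \<longleftrightarrow> (\<forall>j<n. (\<Sum>i<n. M $$ (i, j) * v $ i) = 0)"
      using v M by (subst vec_eq_iff) (auto simp: mult simp del: index_mult_mat_vec)
  qed
  also have "\<dots> \<longleftrightarrow> (\<exists>w. (\<exists>i<n. w i \<noteq> 0) \<and> (\<forall>j<n. (\<Sum>i<n. M $$ (i, j) * w i) = 0))"
  proof
    assume "\<exists>w. (\<exists>i<n. w i \<noteq> 0) \<and> (\<forall>j<n. (\<Sum>i<n. M $$ (i, j) * w i) = 0)"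
    then obtain w where "\<exists>i<n. w i \<noteq> 0" "\<forall>j<n. (\<Sum>i<n. M $$ (i, j) * w i) = 0"
      by blast
    then show "\<exists>v. v \<in> carrier_vec n \<and> (\<exists>i<n. v $ i \<noteq> 0) \<and>
        (\<forall>j<n. (\<Sum>i<n. M $$ (i, j) * v $ i) = 0)"
      by (intro exI[of _ "vec n w"]) auto
  qed blast
  finally show ?thesis .
qed

lemma det_eq_0_if_zero_row:
  fixes M :: "'a::field mat"
  assumes "M \<in> carrier_mat n n" "i < n" "\<And>j. j < n \<Longrightarrow> M $$ (i, j) = 0"
  shows "det M = 0"
  unfolding det_eq_0_iff_left_kernel[OF assms(1)]
  \<comment> \<open>The unit vector of the zero row lies in the left kernel.\<close>
  using assms(2,3) by (intro exI[of _ "\<lambda>k. if k = i then 1 else 0"])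
    (auto simp: if_distrib[of "times _"] cong: if_cong)

section \<open>Comparing the left kernels of the split matrix and of \<open>A\<close>\<close>

context sparse_matrix
begin

text \<open>If each split row gets the weight of the row it comes from, the pieces of a row add up
  again. The sum over positions is turned into a sum over listed entries, and then into one over the
  rows of \<open>A\<close> that are non-zero in column \<open>j\<close>.\<close>

lemma split_mat_old_column:
  assumes "j < n"
  shows "(\<Sum>i<D. split_mat n L $$ (i, j) * u (R i)) = (\<Sum>x<n. A $$ (x, j) * u x)"
proof -
  let ?g = "\<lambda>(x, c, a). if c = j then a * u x else 0"
  have j: "j < D"
    using assms by (simp add: split_dim_def)
  have "(\<Sum>i<D. split_mat n L $$ (i, j) * u (R i)) =
      (\<Sum>i<length L. split_mat n L $$ (i, j) * u (R i))"
  proof (intro sum.mono_neutral_right ballI)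
    fix i assume "i \<in> {..<D} - {..<length L}"
    then have "split_mat n L $$ (i, j) = 0"
      using split_mat_nonzero_row[of i j] j by auto
    then show "split_mat n L $$ (i, j) * u (R i) = 0"
      by simp
  qed (use length_L_le_split_dim in auto)
  also have "\<dots> = (\<Sum>i<length L. ?g (L ! i))"
    using length_L_le_split_dim assms j
    by (intro sum.cong) (auto simp: split_mat_def case_prod_beta)
  also have "\<dots> = sum ?g (set L)"
    using bij_betw_nth[OF distinct_L] by (intro sum.reindex_bij_betw) auto
  also have "\<dots> = sum ?g ((\<lambda>x. (x, j, A $$ (x, j))) ` {x. x < n \<and> A $$ (x, j) \<noteq> 0})"
    using assms by (intro sum.mono_neutral_right) (simp, auto simp: set_L)
  also have "\<dots> = (\<Sum>x | x < n \<and> A $$ (x, j) \<noteq> 0. A $$ (x, j) * u x)"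
    by (subst sum.reindex) (auto simp: inj_on_def)
  also have "\<dots> = (\<Sum>x<n. A $$ (x, j) * u x)"
    by (intro sum.mono_neutral_left) auto
  finally show ?thesis .
qed

text \<open>For a left kernel vector this says that the weights at the two ends of the link
  agree.\<close>

lemma split_mat_new_column:
  assumes "t < length (entry_links L)"
  shows "(\<Sum>i<D. split_mat n L $$ (i, n + t) * w i) =
    w (fst (entry_links L ! t)) - w (snd (entry_links L ! t))"
proof -
  let ?p = "fst (entry_links L ! t)" and ?q = "snd (entry_links L ! t)"
  have pq: "?p < ?q" "?q < D"
    using links_nth[OF assms] length_L_le_split_dim by simp_all
  have "(\<Sum>i<D. split_mat n L $$ (i, n + t) * w i) =
      (\<Sum>i\<in>{?p, ?q}. split_mat n L $$ (i, n + t) * w i)"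
    using pq assms by (intro sum.mono_neutral_right) (auto simp: split_mat_def split_dim_def)
  also have "\<dots> = w ?p - w ?q"
    using pq assms by (simp add: split_mat_def split_dim_def)
  finally show ?thesis .
qed

text \<open>Without padding, \<open>w i = u (R i)\<close> matches the two left kernels: the new
  columns force \<open>w\<close> to be constant on each row of \<open>A\<close>, and the old columns
  then are the equations for \<open>u\<close>. With padding, both matrices have a zero row.\<close>

lemma det_split_mat_eq_0_iff: "det (split_mat n L) = 0 \<longleftrightarrow> det A = 0"
proof (cases "D = length L")
  case True
  then have occ: "\<exists>i<D. R i = x" if "x < n" for x
    using split_dim_eq_length_iff that by simp
  have "(\<exists>w. (\<exists>i<D. w i \<noteq> 0) \<and> (\<forall>j<D. (\<Sum>i<D. split_mat n L $$ (i, j) * w i) = 0)) \<longleftrightarrow>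
      (\<exists>u. (\<exists>x<n. u x \<noteq> 0) \<and> (\<forall>j<n. (\<Sum>x<n. A $$ (x, j) * u x) = 0))" (is "?l \<longleftrightarrow> ?r")
  proof
    assume ?l
    then obtain w i where w: "i < D" "w i \<noteq> 0"
      "\<And>j. j < D \<Longrightarrow> (\<Sum>i<D. split_mat n L $$ (i, j) * w i) = 0"
      by blast
    have link: "w p = w q" if pq: "(p, q) \<in> set (entry_links L)" for p q
    proof -
      obtain t where "t < length (entry_links L)" "entry_links L ! t = (p, q)"
        using pq by (auto simp: in_set_conv_nth)
      then show ?thesis
        using w(3)[of "n + t"] split_mat_new_column[of t w] by (simp add: split_dim_def)
    qed
    have const: "w i = w j" if "i < D" "j < D" "R i = R j" for i j
      by (rule constant_on_rows_if_links[of R "length L", OF link]) (use that in \<open>simp_all only: True\<close>)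
    \<comment> \<open>By \<open>const\<close> any entry of row \<open>x\<close> may represent it,
      and by \<open>occ\<close> there is one for each \<open>x\<close> below
      \<open>n\<close>.\<close>
    define u where "u x = w (SOME i. i < D \<and> R i = x)" for x
    have u: "u (R i) = w i" if "i < D" for i
    proof -
      have "(SOME k. k < D \<and> R k = R i) < D \<and> R (SOME k. k < D \<and> R k = R i) = R i"
        using that by (intro someI[of "\<lambda>k. k < D \<and> R k = R i" i]) simp
      then show ?thesis
        unfolding u_def using that by (intro const) simp_all
    qed
    have "u (R i) \<noteq> 0" "R i < n"
      using w(1,2) True by (simp_all only: u entry(1) not_False_eq_True)
    moreover have "(\<Sum>x<n. A $$ (x, j) * u x) = 0" if "j < n" for j
      using w(3)[of j] split_mat_old_column[OF that, of u] that u by (simp add: split_dim_def)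
    ultimately show ?r
      by blast
  next
    assume ?r
    then obtain u x where u: "x < n" "u x \<noteq> 0"
      "\<And>j. j < n \<Longrightarrow> (\<Sum>x<n. A $$ (x, j) * u x) = 0"
      by blast
    have "(\<Sum>i<D. split_mat n L $$ (i, j) * u (R i)) = 0" if "j < D" for j
    proof (cases "j < n")
      case True
      then show ?thesis
        using u(3) split_mat_old_column by simp
    next
      case False
      then obtain t where "j = n + t" "t < length (entry_links L)"
        using \<open>j < D\<close> by (metis add_less_cancel_left le_add_diff_inverse not_less split_dim_def)
      then show ?thesis
        using split_mat_new_column[of t "\<lambda>i. u (R i)"] links_nth(3)[of t R "length L"] by simp
    qed
    \<comment> \<open>Row \<open>x\<close> has an entry, so the non-zero \<open>u x\<close> survives
      as a component of the lifted vector.\<close>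
    then show ?l
      using occ[OF u(1)] u(2) by (intro exI[of _ "\<lambda>i. u (R i)"]) auto
  qed
  then show ?thesis
    using det_eq_0_iff_left_kernel[OF split_mat_carrier] det_eq_0_iff_left_kernel[OF A] by simp
next
  case False
  then obtain x where x: "x < n" "\<And>i. i < length L \<Longrightarrow> R i \<noteq> x"
    using split_dim_eq_length_iff by blast
  have zero_row: "A $$ (x, j) = 0" if "j < n" for j
  proof (rule ccontr)
    assume "A $$ (x, j) \<noteq> 0"
    then have "(x, j, A $$ (x, j)) \<in> set L"
      using x(1) that by (simp add: set_L)
    then show False
      using x(2) by (metis fst_conv in_set_conv_nth)
  qed
  have "det A = 0"
    by (rule det_eq_0_if_zero_row[OF A x(1) zero_row])
  \<comment> \<open>Here \<open>length L < D\<close>, and row \<open>length L\<close> is the first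
    padding row.\<close>
  moreover have "det (split_mat n L) = 0"
    using False length_L_le_split_dim split_mat_nonzero_row[of "length L"]
    by (intro det_eq_0_if_zero_row[OF split_mat_carrier, of "length L"]) auto
  ultimately show ?thesis
    by simp
qed

end

section \<open>The program\<close>

definition set_word :: "nat \<Rightarrow> nat \<Rightarrow> nat \<Rightarrow> memory \<Rightarrow> memory" where
  "set_word a i v s = s\<lparr>wmem := (wmem s)(a := (wmem s a)(i := v))\<rparr>"

definition set_real :: "nat \<Rightarrow> nat \<Rightarrow> real \<Rightarrow> memory \<Rightarrow> memory" where
  "set_real a i v s = s\<lparr>rmem := (rmem s)(a := (rmem s a)(i := v))\<rparr>"

lemma set_word_simps [simp]:
  "wmem (set_word a i v s) = (wmem s)(a := (wmem s a)(i := v))"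
  "rmem (set_word a i v s) = rmem s"
  "wmem (set_real a i x s) = wmem s"
  "rmem (set_real a i x s) = (rmem s)(a := (rmem s a)(i := x))"
  by (simp_all add: set_word_def set_real_def)

lemma exec_WWrite:
  "weval s i = j \<Longrightarrow> weval s e = v \<Longrightarrow> s' = set_word a j v s \<Longrightarrow> exec (WWrite a i e) s 1 s'"
  unfolding set_word_def by (metis exec.WWrite)

lemma exec_WWrite_Seq:
  "weval s i = j \<Longrightarrow> weval s e = v \<Longrightarrow> s1 = set_word a j v s \<Longrightarrow> exec Q s1 t s' \<Longrightarrow>
    exec (Seq (WWrite a i e) Q) s (1 + t) s'"
  by (metis exec_WWrite exec.Seq)

lemma exec_RWrite_Seq:
  "weval s i = j \<Longrightarrow> reval s e = x \<Longrightarrow> s1 = set_real a j x s \<Longrightarrow> exec Q s1 t s' \<Longrightarrow>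
    exec (Seq (RWrite a i e) Q) s (1 + t) s'"
  unfolding set_real_def by (metis exec.RWrite exec.Seq)

text \<open>Word arrays: 0 input, 1 output, 2 the table \<open>last_in_row\<close>; cell 0 of the arrays 3, 4, 5, 6
  holds the number of entries output so far, four times this number, the next new column and the
  loop counter.\<close>

abbreviation scalar :: "nat \<Rightarrow> wexp" where
  "scalar a \<equiv> WRead a (WConst 0)"

abbreviation incr :: "wexp \<Rightarrow> nat \<Rightarrow> wexp" where
  "incr e k \<equiv> WAdd e (WConst k)"

text \<open>The offset 2 leaves room for the dimension and the number of entries. An entry takes
  four words: row, column, the length 1 of the monomial, and its variable. Array 4 tracks the word
  position because words cannot be multiplied.\<close>

definition emit :: "wexp \<Rightarrow> wexp \<Rightarrow> rexp \<Rightarrow> prog" where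
  "emit r c x =
     Seq (WWrite 1 (incr (scalar 4) 2) r)
    (Seq (WWrite 1 (incr (scalar 4) 3) c)
    (Seq (WWrite 1 (incr (scalar 4) 4) (WConst 1))
    (Seq (WWrite 1 (incr (scalar 4) 5) (incr r 1))
    (Seq (RWrite 1 (scalar 3) x)
    (Seq (WWrite 4 (WConst 0) (incr (scalar 4) 4))
         (WWrite 3 (WConst 0) (incr (scalar 3) 1)))))))"

definition entry_words :: "scalar_list \<Rightarrow> nat list" where
  "entry_words E = concat (map (\<lambda>(r, c, a). [r, c, 1, Suc r]) E)"

definition emitted :: "memory \<Rightarrow> scalar_list \<Rightarrow> bool" where
  "emitted s E \<longleftrightarrow> wmem s 3 0 = length E \<and> wmem s 4 0 = 4 * length E \<and>
     (\<forall>i<4 * length E. wmem s 1 (i + 2) = entry_words E ! i) \<and>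
     (\<forall>i<length E. rmem s 1 i = entry_val E i)"

definition same_except_output :: "memory \<Rightarrow> memory \<Rightarrow> bool" where
  "same_except_output s s' \<longleftrightarrow>
     (\<forall>a. a \<notin> {1, 3, 4} \<longrightarrow> wmem s' a = wmem s a) \<and> (\<forall>a. a \<noteq> 1 \<longrightarrow> rmem s' a = rmem s a)"

lemma same_except_output_trans:
  "same_except_output s s' \<Longrightarrow> same_except_output s' s'' \<Longrightarrow> same_except_output s s''"
  by (simp add: same_except_output_def)

lemma length_entry_words: "length (entry_words E) = 4 * length E"
  by (induction E) (auto simp: entry_words_def)

lemma emitted_append:
  assumes "emitted s E" "wmem s' 3 0 = Suc (length E)" "wmem s' 4 0 = 4 * length E + 4"
    and "\<And>i. i < 4 * length E \<Longrightarrow> wmem s' 1 (i + 2) = wmem s 1 (i + 2)"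
    and "wmem s' 1 (4 * length E + 2) = r" "wmem s' 1 (4 * length E + 3) = c"
    and "wmem s' 1 (4 * length E + 4) = 1" "wmem s' 1 (4 * length E + 5) = Suc r"
    and "\<And>i. i < length E \<Longrightarrow> rmem s' 1 i = rmem s 1 i" "rmem s' 1 (length E) = x"
  shows "emitted s' (E @ [(r, c, x)])"
proof -
  have words: "entry_words (E @ [(r, c, x)]) = entry_words E @ [r, c, 1, Suc r]"
    by (simp add: entry_words_def)
  have "wmem s' 1 (i + 2) = entry_words (E @ [(r, c, x)]) ! i" if "i < 4 * length E + 4" for i
  proof (cases "i < 4 * length E")
    case True
    then show ?thesis
      using assms(1,4) by (simp add: words nth_append length_entry_words emitted_def)
  next
    case False
    define j where "j = i - 4 * length E"
    have "j \<in> {0, 1, 2, 3}" "i = 4 * length E + j"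
      using that False by (auto simp: j_def)
    then show ?thesis
      using assms(5-8) by (auto simp: words nth_append length_entry_words numeral_eq_Suc)
  qed
  moreover have "rmem s' 1 i = entry_val (E @ [(r, c, x)]) i" if "i < Suc (length E)" for i
    using assms(1,9,10) that by (cases "i = length E") (auto simp: nth_append emitted_def)
  ultimately show ?thesis
    using assms(2,3) by (simp add: emitted_def)
qed

text \<open>The arguments are evaluated between the writes, \<open>r\<close> even twice, so their
  values have to survive any change of the output arrays and their counters.\<close>

lemma exec_emit:
  assumes "emitted s E"
    and "\<And>s'. same_except_output s s' \<Longrightarrow> weval s' r = i \<and> weval s' c = j \<and> reval s' e = x"
  shows "\<exists>s'. exec (emit r c e) s 7 s' \<and> same_except_output s s' \<and> emitted s' (E @ [(i, j, x)])"
proof -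
  let ?p = "4 * length E"
  define s1 where "s1 = set_word 1 (?p + 2) i s"
  define s2 where "s2 = set_word 1 (?p + 3) j s1"
  define s3 where "s3 = set_word 1 (?p + 4) 1 s2"
  define s4 where "s4 = set_word 1 (?p + 5) (i + 1) s3"
  define s5 where "s5 = set_real 1 (length E) x s4"
  define s6 where "s6 = set_word 4 0 (?p + 4) s5"
  define s7 where "s7 = set_word 3 0 (length E + 1) s6"
  note defs = s1_def s2_def s3_def s4_def s5_def s6_def s7_def
  have same: "same_except_output s s" "same_except_output s s1" "same_except_output s s2"
    "same_except_output s s3" "same_except_output s s4" "same_except_output s s7"
    by (simp_all add: same_except_output_def defs)
  have pos: "wmem s 4 0 = ?p" "wmem s 3 0 = length E"
    using assms(1) by (simp_all add: emitted_def)
  have "exec (emit r c e) s (1 + (1 + (1 + (1 + (1 + (1 + 1)))))) s7"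
    unfolding emit_def
  proof (intro exec_WWrite_Seq[OF _ _ s1_def] exec_WWrite_Seq[OF _ _ s2_def]
      exec_WWrite_Seq[OF _ _ s3_def] exec_WWrite_Seq[OF _ _ s4_def]
      exec_RWrite_Seq[OF _ _ s5_def] exec_WWrite_Seq[OF _ _ s6_def] exec_WWrite[OF _ _ s7_def])
    show "weval s r = i" "weval s1 c = j" "weval s3 (incr r 1) = i + 1" "reval s4 e = x"
      using assms(2)[OF same(1)] assms(2)[OF same(2)] assms(2)[OF same(4)] assms(2)[OF same(5)]
      by simp_all
  qed (simp_all add: defs pos)
  then have "exec (emit r c e) s 7 s7"
    by (simp add: numeral_eq_Suc)
  moreover have "emitted s7 (E @ [(i, j, x)])"
    by (rule emitted_append[OF assms(1)]) (simp_all add: defs)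
  ultimately show ?thesis
    using same(6) by (intro exI[of _ s7]) simp
qed

section \<open>The loop over the entries\<close>

abbreviation row_exp :: wexp where
  "row_exp \<equiv> WRead 0 (incr (WAdd (scalar 6) (scalar 6)) 2)"

abbreviation col_exp :: wexp where
  "col_exp \<equiv> WRead 0 (incr (WAdd (scalar 6) (scalar 6)) 3)"

text \<open>The table is overwritten only after the conditional, which still needs the previous
  entry of the row. The counter is advanced last, since \<open>row_exp\<close> depends on
  it.\<close>

definition body :: prog where
  "body =
     Seq (emit (scalar 6) col_exp (RRead 0 (scalar 6)))
    (Seq (Cond (WLess (WConst 0) (WRead 2 row_exp))
           (Seq (emit (WSub (WRead 2 row_exp) (WConst 1)) (scalar 5) (RConst 1))
           (Seq (emit (scalar 6) (scalar 5) (RConst (-1)))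
                (WWrite 5 (WConst 0) (incr (scalar 5) 1))))
           Skip)
    (Seq (WWrite 2 row_exp (incr (scalar 6) 1))
         (WWrite 6 (WConst 0) (incr (scalar 6) 1))))"

definition loop :: prog where
  "loop = While (WLess (scalar 6) (WRead 0 (WConst 1))) body"

text \<open>New columns are numbered from \<open>n\<close>. The two leading words are written at the
  end, when the dimension and the number of entries are known.\<close>

definition reduction :: prog where
  "reduction =
     Seq (WWrite 5 (WConst 0) (scalar 0))
    (Seq loop
    (Seq (WWrite 1 (WConst 0) (scalar 5))
         (WWrite 1 (WConst 1) (scalar 3))))"

definition loop_inv :: "nat \<Rightarrow> scalar_list \<Rightarrow> nat \<Rightarrow> memory \<Rightarrow> bool" where
  "loop_inv n L k s \<longleftrightarrow>
     wmem s 0 = array_of (scalar_words n L) 0 \<and> rmem s 0 = array_of (scalar_reals L) 0 \<and>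
     wmem s 2 = last_in_row (entry_row L) k \<and>
     wmem s 5 0 = n + length (links (entry_row L) k) \<and> wmem s 6 0 = k \<and>
     emitted s (split_entries n L k)"

lemma nth_entry_coordinates:
  assumes "k < length L"
  shows "2 * k + 1 < length (concat (map (\<lambda>(r, c, a). [r, c]) L)) \<and>
    concat (map (\<lambda>(r, c, a). [r, c]) L) ! (2 * k) = fst (L ! k) \<and>
    concat (map (\<lambda>(r, c, a). [r, c]) L) ! (2 * k + 1) = fst (snd (L ! k))"
  using assms
proof (induction L arbitrary: k)
  case (Cons x L)
  obtain r c a where "x = (r, c, a)"
    by (cases x)
  then show ?case
    using Cons.IH[of "k - 1"] Cons.prems by (cases k) (simp_all add: case_prod_beta)
qed simp

lemma array_of_scalar_words:
  "array_of (scalar_words n L) 0 0 = n" "array_of (scalar_words n L) 0 (Suc 0) = length L"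
  "k < length L \<Longrightarrow> array_of (scalar_words n L) 0 (k + k + 2) = entry_row L k"
  "k < length L \<Longrightarrow> array_of (scalar_words n L) 0 (k + k + 3) = entry_col L k"
proof -
  have idx: "k + k + 2 = Suc (Suc (2 * k))" "k + k + 3 = Suc (Suc (2 * k + 1))"
    by simp_all
  show "array_of (scalar_words n L) 0 0 = n" "array_of (scalar_words n L) 0 (Suc 0) = length L"
    by (simp_all add: array_of_def scalar_words_def)
  assume "k < length L"
  from nth_entry_coordinates[OF this]
  show "array_of (scalar_words n L) 0 (k + k + 2) = entry_row L k"
    "array_of (scalar_words n L) 0 (k + k + 3) = entry_col L k"
    unfolding idx array_of_def scalar_words_def by simp_all
qed

lemma array_of_scalar_reals:
  "k < length L \<Longrightarrow> array_of (scalar_reals L) 0 k = entry_val L k"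
  by (simp add: array_of_def scalar_reals_def case_prod_beta)

lemma exec_body:
  assumes inv: "loop_inv n L k s" and k: "k < length L"
  shows "\<exists>t s'. t \<le> 25 \<and> exec body s t s' \<and> loop_inv n L (Suc k) s'"
proof -
  let ?R = "entry_row L"
  let ?l = "last_in_row ?R k (?R k)" and ?c = "n + length (links ?R k)"
  let ?E = "split_entries n L k" and ?e = "(k, entry_col L k, entry_val L k)"
  note inv = inv[unfolded loop_inv_def]
  note array = array_of_scalar_words(3,4)[OF k, of n] array_of_scalar_reals[OF k]
  \<comment> \<open>None of these expressions reads an array that \<open>emit\<close> changes, so
    they keep their values throughout the following calls of \<open>emit\<close>.\<close>
  have eval: "weval s' (scalar 6) = k" "weval s' (scalar 5) = ?c" "weval s' row_exp = ?R k"
    "weval s' (WRead 2 row_exp) = ?l" "weval s' (WSub (WRead 2 row_exp) (WConst 1)) = ?l - 1"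
    "weval s' col_exp = entry_col L k" "reval s' (RRead 0 (scalar 6)) = entry_val L k"
    "reval s' (RConst 1) = 1" "reval s' (RConst (-1)) = -1"
    if "same_except_output s s'" for s'
    using that inv array by (simp_all add: same_except_output_def)
  have "emitted s ?E"
    using inv by blast
  then have "\<exists>s1. exec (emit (scalar 6) col_exp (RRead 0 (scalar 6))) s 7 s1 \<and>
      same_except_output s s1 \<and> emitted s1 (?E @ [?e])"
    by (rule exec_emit) (intro conjI eval)
  then obtain s1 where s1: "exec (emit (scalar 6) col_exp (RRead 0 (scalar 6))) s 7 s1"
    "same_except_output s s1" "emitted s1 (?E @ [?e])"
    by blast
  note eval1 = eval[OF s1(2)]
  \<comment> \<open>The bound 16 is one test, two calls of \<open>emit\<close> with 7 steps each,
    and one increment.\<close>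
  obtain t s2 where s2: "t \<le> 16"
    "exec (Cond (WLess (WConst 0) (WRead 2 row_exp))
           (Seq (emit (WSub (WRead 2 row_exp) (WConst 1)) (scalar 5) (RConst 1))
           (Seq (emit (scalar 6) (scalar 5) (RConst (-1)))
                (WWrite 5 (WConst 0) (incr (scalar 5) 1))))
           Skip) s1 t s2"
    "emitted s2 (split_entries n L (Suc k))"
    "wmem s2 5 0 = n + length (links ?R (Suc k))"
    "wmem s2 0 = wmem s 0" "rmem s2 0 = rmem s 0" "wmem s2 2 = wmem s 2" "wmem s2 6 0 = k"
  proof (cases "?l = 0")
    case True
    show ?thesis
    proof (rule that)
      show "exec (Cond (WLess (WConst 0) (WRead 2 row_exp))
           (Seq (emit (WSub (WRead 2 row_exp) (WConst 1)) (scalar 5) (RConst 1))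
           (Seq (emit (scalar 6) (scalar 5) (RConst (-1)))
                (WWrite 5 (WConst 0) (incr (scalar 5) 1))))
           Skip) s1 (1 + 1) s1"
        using eval1(4) True by (intro exec.CondFalse exec.Skip) simp
    qed (use s1 inv eval1 True in \<open>simp_all add: same_except_output_def\<close>)
  next
    case False
    have "\<exists>s3. exec (emit (WSub (WRead 2 row_exp) (WConst 1)) (scalar 5) (RConst 1)) s1 7 s3 \<and>
        same_except_output s1 s3 \<and> emitted s3 ((?E @ [?e]) @ [(?l - 1, ?c, 1)])"
      by (rule exec_emit[OF s1(3)])
        (intro conjI eval[OF same_except_output_trans[OF s1(2)]])
    then obtain s3 where s3:
      "exec (emit (WSub (WRead 2 row_exp) (WConst 1)) (scalar 5) (RConst 1)) s1 7 s3"
      "same_except_output s1 s3" "emitted s3 ((?E @ [?e]) @ [(?l - 1, ?c, 1)])"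
      by blast
    note same3 = same_except_output_trans[OF s1(2) s3(2)]
    have "\<exists>s4. exec (emit (scalar 6) (scalar 5) (RConst (-1))) s3 7 s4 \<and>
        same_except_output s3 s4 \<and>
        emitted s4 (((?E @ [?e]) @ [(?l - 1, ?c, 1)]) @ [(k, ?c, -1)])"
      by (rule exec_emit[OF s3(3)])
        (intro conjI eval[OF same_except_output_trans[OF same3]])
    then obtain s4 where s4: "exec (emit (scalar 6) (scalar 5) (RConst (-1))) s3 7 s4"
      "same_except_output s3 s4" "emitted s4 (((?E @ [?e]) @ [(?l - 1, ?c, 1)]) @ [(k, ?c, -1)])"
      by blast
    note same4 = same_except_output_trans[OF same3 s4(2)]
    show ?thesis
    proof (rule that)
      show "exec (Cond (WLess (WConst 0) (WRead 2 row_exp))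
           (Seq (emit (WSub (WRead 2 row_exp) (WConst 1)) (scalar 5) (RConst 1))
           (Seq (emit (scalar 6) (scalar 5) (RConst (-1)))
                (WWrite 5 (WConst 0) (incr (scalar 5) 1))))
           Skip) s1 ((7 + (7 + 1)) + 1) (set_word 5 0 (?c + 1) s4)"
        using eval1(4) False eval(2)[OF same4]
        by (intro exec.CondTrue exec.Seq[OF s3(1)] exec.Seq[OF s4(1)] exec_WWrite[OF _ _ refl]) simp_all
    qed (use s4(3) inv same4 eval(1)[OF same4] False in
        \<open>simp_all add: same_except_output_def emitted_def Let_def\<close>)
  qed
  let ?s' = "set_word 6 0 (k + 1) (set_word 2 (?R k) (k + 1) s2)"
  have "exec body s (7 + (t + (1 + 1))) ?s'"
    unfolding body_def
    using s2 inv array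
    by (intro exec.Seq[OF s1(1)] exec.Seq[OF s2(2)] exec_WWrite_Seq[OF _ _ refl] exec_WWrite) simp_all
  moreover have "loop_inv n L (Suc k) ?s'"
    using s2 inv unfolding loop_inv_def emitted_def by simp
  ultimately show ?thesis
    using s2(1) by (intro exI[of _ "7 + (t + (1 + 1))"] exI[of _ ?s']) simp
qed

text \<open>Each round costs at most 25 steps for the body and one for the test; the final test adds
  1. The induction descends from \<open>length L\<close>.\<close>

lemma exec_loop:
  assumes "k \<le> length L" "loop_inv n L k s"
  shows "\<exists>t s'. t \<le> 26 * (length L - k) + 1 \<and> exec loop s t s' \<and> loop_inv n L (length L) s'"
  using assms
proof (induction k arbitrary: s rule: inc_induct)
  case base
  then have "\<not> beval s (WLess (scalar 6) (WRead 0 (WConst 1)))"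
    by (simp add: loop_inv_def array_of_scalar_words)
  then show ?case
    using base unfolding loop_def by (blast intro: exec.WhileFalse le_add2)
next
  case (step k)
  then obtain t s' where s': "t \<le> 25" "exec body s t s'" "loop_inv n L (Suc k) s'"
    using exec_body by blast
  then obtain t' s'' where s'': "t' \<le> 26 * (length L - Suc k) + 1" "exec loop s' t' s''"
    "loop_inv n L (length L) s''"
    using step.IH by blast
  have "beval s (WLess (scalar 6) (WRead 0 (WConst 1)))"
    using step by (simp add: loop_inv_def array_of_scalar_words)
  then have "exec loop s (t + t' + 1) s''"
    using s'(2) s''(2) unfolding loop_def by (rule exec.WhileTrue)
  moreover have "t + t' + 1 \<le> 26 * (length L - k) + 1"
    using s'(1) s''(1) step.hyps by simp
  ultimately show ?case
    using s''(3) by blast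
qed

lemma exec_reduction:
  "\<exists>t s. t \<le> 26 * length L + 4 \<and> exec reduction (input_memory n L) t s \<and>
     emitted s (split_entries n L (length L)) \<and>
     wmem s 1 0 = split_dim n L \<and> wmem s 1 1 = length (split_entries n L (length L))"
proof -
  let ?s0 = "set_word 5 0 n (input_memory n L)"
  \<comment> \<open>All memory outside the input is initially zero, which is the right start for the
    table and the counters.\<close>
  have "loop_inv n L 0 ?s0"
    by (auto simp: loop_inv_def input_memory_def emitted_def array_of_def)
  from exec_loop[OF le0 this] obtain t s where s: "t \<le> 26 * length L + 1" "exec loop ?s0 t s"
    "loop_inv n L (length L) s"
    by auto
  let ?s1 = "set_word 1 0 (split_dim n L) s"
  let ?s2 = "set_word 1 1 (length (split_entries n L (length L))) ?s1"
  \<comment> \<open>Three assignments outside the loop raise the additive constant from 1 to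
    4.\<close>
  have "exec reduction (input_memory n L) (1 + (t + (1 + 1))) ?s2"
    unfolding reduction_def using s(3)
    by (intro exec_WWrite_Seq[OF _ _ refl exec.Seq[OF s(2)]] exec_WWrite_Seq[OF _ _ refl] exec_WWrite)
      (simp_all add: input_memory_def array_of_scalar_words loop_inv_def emitted_def split_dim_def)
  moreover have "emitted ?s2 (split_entries n L (length L))"
    using s(3) by (simp add: loop_inv_def emitted_def)
  ultimately show ?thesis
    using s(1) by (intro exI[of _ "1 + (t + (1 + 1))"] exI[of _ ?s2]) simp
qed

section \<open>Decoding the output and assembling the reduction\<close>

lemma symbolic_words_single_vars:
  "symbolic_words d (map (\<lambda>(r, c, a). (r, c, [Suc r], a)) E) = d # length E # entry_words E"
  by (induction E) (auto simp: symbolic_words_def entry_words_def)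

lemma output_of_row_vars:
  assumes "lists_scalar E M" "emitted s E" "wmem s 1 0 = dim_row M" "wmem s 1 1 = length E"
  shows "output_of s (row_vars M)"
  unfolding output_of_def
proof (intro exI conjI allI impI)
  let ?L = "map (\<lambda>(r, c, a). (r, c, [Suc r], a)) E"
  show "lists_symbolic ?L (row_vars M)"
    using assms(1) by (rule lists_symbolic_row_vars)
  fix i
  show "wmem s 1 i = symbolic_words (dim_row (row_vars M)) ?L ! i"
    if "i < length (symbolic_words (dim_row (row_vars M)) ?L)"
  proof (cases "i < 2")
    case True
    then have "i = 0 \<or> i = 1"
      by auto
    then show ?thesis
      using assms(3,4) by (auto simp: symbolic_words_single_vars)
  next
    case False
    then obtain j where "i = j + 2"
      by (metis add.commute le_Suc_ex not_less)
    then show ?thesis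
      using that assms(2) by (simp add: symbolic_words_single_vars length_entry_words emitted_def)
  qed
  show "rmem s 1 i = symbolic_reals ?L ! i" if "i < length (symbolic_reals ?L)"
    using that assms(2) by (simp add: symbolic_reals_def emitted_def case_prod_beta)
qed

lemma (in sparse_matrix) reduction_correct:
  "\<exists>t s B. exec reduction (input_memory n L) t s \<and> t \<le> 26 * nnz_scalar A + 4 \<and> output_of s B \<and>
     B \<in> SM (n\<^sup>2) 1 3 \<and> square_mat B \<and> nnz_symbolic B \<le> 3 * nnz_scalar A \<and>
     (det A = 0 \<longleftrightarrow> det B = 0)"
proof -
  let ?M = "split_mat n L"
  obtain t s where "t \<le> 26 * length L + 4" "exec reduction (input_memory n L) t s"
    and out: "emitted s (split_entries n L (length L))" "wmem s 1 0 = D"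
      "wmem s 1 1 = length (split_entries n L (length L))"
    using exec_reduction by blast
  moreover have "output_of s (row_vars ?M)"
    using out by (intro output_of_row_vars[OF lists_split_mat]) simp_all
  \<comment> \<open>Non-zero rows have indices below \<open>length L\<close>, which is at most the
    square of \<open>n\<close>, so there are enough variables.\<close>
  moreover have "row_vars ?M \<in> SM (n\<^sup>2) 1 3"
    using card_row_split_mat split_mat_nonzero_row length_L_le
    by (intro row_vars_in_SM) (auto intro: less_le_trans)
  moreover have "nnz_symbolic (row_vars ?M) \<le> 3 * length L"
    using card_row_split_mat split_mat_nonzero_row by (intro nnz_row_vars_le) auto
  \<comment> \<open>The determinant of the scaled matrix is a single monomial with coefficient
    \<open>det ?M\<close>.\<close>
  moreover have "det A = 0 \<longleftrightarrow> det (row_vars ?M) = 0"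
    by (simp add: det_row_vars[OF split_mat_carrier] det_split_mat_eq_0_iff single_eq_0_iff)
  ultimately show ?thesis
    unfolding nnz_A by (intro exI[of _ t] exI[of _ s] exI[of _ "row_vars ?M"]) simp
qed

lemma affine_in_bigo: "(\<lambda>N. real (a * N + b)) \<in> O(\<lambda>N. real N)"
proof (rule landau_o.bigI[of "real (a + b) + 1"])
  show "\<forall>\<^sub>F N in at_top. norm (real (a * N + b)) \<le> (real (a + b) + 1) * norm (real N)"
  proof (rule eventually_sequentiallyI[of 1])
    fix N :: nat assume "1 \<le> N"
    \<comment> \<open>For positive \<open>N\<close> the constant \<open>b\<close> is absorbed into
      \<open>b * N\<close>.\<close>
    then have "b * 1 \<le> b * N"
      by (rule mult_le_mono2)
    then have "a * N + b \<le> (a + b + 1) * N"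
      unfolding add_mult_distrib by linarith
    then have "real (a * N + b) \<le> real ((a + b + 1) * N)"
      by (rule of_nat_mono)
    then show "norm (real (a * N + b)) \<le> (real (a + b) + 1) * norm (real N)"
      by (simp add: algebra_simps)
  qed
qed simp

theorem theorem4p8:
  shows "\<exists>f :: nat \<Rightarrow> nat. (\<lambda>N. real (f N)) \<in> O(\<lambda>N. real N) \<and>
    decisional_reducible f (\<lambda>n. carrier_mat n n) (\<lambda>n. SM (n\<^sup>2) 1 3)"
proof (intro exI conjI)
  \<comment> \<open>The factor 3 is the bound on the non-zero entries per row; there is one row for
    each entry of \<open>A\<close>.\<close>
  show "(\<lambda>N. real (3 * N)) \<in> O(\<lambda>N. real N)"
    using affine_in_bigo[of 3 0] by simp
  show "decisional_reducible (\<lambda>N. 3 * N) (\<lambda>n. carrier_mat n n) (\<lambda>n. SM (n\<^sup>2) 1 3)"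
    unfolding decisional_reducible_def
  proof (rule exI[of _ reduction], rule exI[of _ "\<lambda>N. 26 * N + 4"], intro conjI allI ballI impI)
    show "(\<lambda>N. real (26 * N + 4)) \<in> soft_O (\<lambda>N. real N)"
      \<comment> \<open>The exponent 0 of the iterated logarithm suffices, as the running time is
        linear.\<close>
      unfolding soft_O_def by (rule UN_I[of 0]) (use affine_in_bigo[of 26 4] in simp_all)
  next
    fix n A L assume "A \<in> carrier_mat n n \<inter> carrier_mat n n" "lists_scalar L A"
    then have "sparse_matrix n A L"
      by (simp add: sparse_matrix_def)
    then show "\<exists>t s B. exec reduction (input_memory n L) t s \<and> t \<le> 26 * nnz_scalar A + 4 \<and>
        output_of s B \<and> B \<in> SM (n\<^sup>2) 1 3 \<and> square_mat B \<and>
        nnz_symbolic B \<le> 3 * nnz_scalar A \<and> (det A = 0 \<longleftrightarrow> det B = 0)"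
      by (rule sparse_matrix.reduction_correct)
  qed
qed

end
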